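(* Let $G$ be a connected triangle-free graph of order $n \geq 3$. Then $\mathrm{mp}(G) \leq \alpha(G)$. Moreover, if every monophonic path of $G$ has length at most three, then $\mathrm{mp}(G) = \alpha(G)$.
   Context: All graphs are finite, simple and undirected. A path $P$ in $G$ is monophonic (induced) if $G$ contains no edge between vertices that are non-consecutive on $P$; the length of a path is its number of edges. A set $M \subseteq V(G)$ is a monophonic position set (mp-set) if no three vertices of $M$ lie on a common monophonic path in $G$. The monophonic position number $\mathrm{mp}(G)$ is the number of vertices in a largest mp-set of $G$. The independence number $\alpha(G)$ is the number of vertices in a maximum independent set of $G$. *)

theory Defs
  imports "Graph_Theory.Graph_Theory"
begin

text \<open>
  A finite simple undirected graph is modelled by the locale \<^locale>\<open>graph\<close>: a finite, loopfree,
  symmetric digraph without parallel arcs, so that an undirected edge \<open>uv\<close> is the pair of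
  arcs \<open>u \<rightarrow> v\<close> and \<open>v \<rightarrow> u\<close>.
\<close>

definition triangle_free :: "('a, 'b) pre_digraph \<Rightarrow> bool" where
  "triangle_free G \<longleftrightarrow>
    \<not> (\<exists>x y z. x \<rightarrow>\<^bsub>G\<^esub> y \<and> y \<rightarrow>\<^bsub>G\<^esub> z \<and> z \<rightarrow>\<^bsub>G\<^esub> x)"

definition monophonic_path :: "('a, 'b) pre_digraph \<Rightarrow> 'a vwalk \<Rightarrow> bool" where
  "monophonic_path G p \<longleftrightarrow> vpath p G \<and>
    (\<forall>i < length p. \<forall>j < length p. p ! i \<rightarrow>\<^bsub>G\<^esub> p ! j \<longrightarrow> j = Suc i \<or> i = Suc j)"

definition mp_set :: "('a, 'b) pre_digraph \<Rightarrow> 'a set \<Rightarrow> bool" where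
  "mp_set G M \<longleftrightarrow> M \<subseteq> verts G \<and>
    \<not> (\<exists>x\<in>M. \<exists>y\<in>M. \<exists>z\<in>M. x \<noteq> y \<and> y \<noteq> z \<and> x \<noteq> z \<and>
         (\<exists>p. monophonic_path G p \<and> {x, y, z} \<subseteq> set p))"

definition independent_set :: "('a, 'b) pre_digraph \<Rightarrow> 'a set \<Rightarrow> bool" where
  "independent_set G S \<longleftrightarrow> S \<subseteq> verts G \<and> (\<forall>x\<in>S. \<forall>y\<in>S. \<not> x \<rightarrow>\<^bsub>G\<^esub> y)"

text \<open>
  For a finite graph the maxima below range over finite sets, which contain \<open>0\<close> because the
  empty set is both an mp-set and an independent set.
\<close>

definition mp_number :: "('a, 'b) pre_digraph \<Rightarrow> nat" where
  "mp_number G = Max (card ` {M. mp_set G M})"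

definition independence_number :: "('a, 'b) pre_digraph \<Rightarrow> nat" where
  "independence_number G = Max (card ` {S. independent_set G S})"

end

theory Submission
  imports Defs
begin

text \<open>
  If an mp-set contained an edge \<open>uv\<close> and a further vertex \<open>w\<close>, a shortest walk from \<open>w\<close> to
  \<open>{u, v}\<close>, prolonged by the other end of the edge, would be a monophonic path through all three:
  a chord ending in that other end would give a triangle or a shorter walk. So an mp-set is
  independent or has at most two elements, and \<open>\<alpha>(G) \<ge> 2\<close> because three pairwise adjacent
  vertices form a triangle. Conversely, a path with at most four vertices does not contain three
  pairwise non-consecutive ones, so if all monophonic paths are that short, then every
  independent set is an mp-set.
\<close>

section \<open>Walks as vertex lists, and a criterion for monophonic paths\<close>

lemma vwalk_append:
  assumes "vwalk p G" "vwalk q G" "last p \<rightarrow>\<^bsub>G\<^esub> hd q"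
  shows "vwalk (p @ q) G"
  using assms by (auto simp: vwalk_def vwalk_arcs_append)

lemma vwalk_take:
  assumes "vwalk p G" "0 < n"
  shows "vwalk (take n p) G"
proof (rule vwalkI_append_l)
  show "vwalk (take n p @ drop n p) G" using assms by simp
  show "take n p \<noteq> []" using assms by (auto simp: vwalk_def)
qed

lemma vwalk_drop:
  assumes "vwalk p G" "n < length p"
  shows "vwalk (drop n p) G"
proof (rule vwalkI_append_r)
  show "vwalk (take n p @ drop n p) G" using assms by simp
  show "drop n p \<noteq> []" using assms by simp
qed

lemma last_take_Suc: "i < length p \<Longrightarrow> last (take (Suc i) p) = p ! i"
  by (simp add: take_Suc_conv_app_nth)

text \<open>Cutting the walk just after position \<open>i\<close> exposes the joining pair as a
  member of \<open>vwalk_arcs p\<close>, and all members of that list are arcs.\<close>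

lemma vwalk_nth_Suc:
  assumes "vwalk p G" "Suc i < length p"
  shows "p ! i \<rightarrow>\<^bsub>G\<^esub> p ! Suc i"
proof -
  have "vwalk_arcs (take (Suc i) p @ drop (Suc i) p) =
      vwalk_arcs (take (Suc i) p) @ (p ! i, p ! Suc i) # vwalk_arcs (drop (Suc i) p)"
    using assms(2) by (subst vwalk_arcs_append) (auto simp: last_take_Suc hd_drop_conv_nth)
  then have "(p ! i, p ! Suc i) \<in> set (vwalk_arcs p)" by simp
  then show ?thesis using assms(1) by (auto simp: vwalk_def)
qed

text \<open>By symmetry of the arcs, chords need only be excluded from an earlier to a later
  position. The last premise disposes of equal positions, since a \<open>sym_digraph\<close> may
  have loops.\<close>

lemma (in sym_digraph) monophonic_pathI:
  assumes "vwalk p G"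
    and "\<And>i j. i < j \<Longrightarrow> j < length p \<Longrightarrow> p ! i \<noteq> p ! j"
    and "\<And>i j. Suc i < j \<Longrightarrow> j < length p \<Longrightarrow> \<not> p ! i \<rightarrow>\<^bsub>G\<^esub> p ! j"
    and "\<And>x. \<not> x \<rightarrow>\<^bsub>G\<^esub> x"
  shows "monophonic_path G p"
proof -
  have "distinct p"
    unfolding distinct_conv_nth by (metis assms(2) nat_neq_iff)
  moreover have "j = Suc i \<or> i = Suc j"
    if "i < length p" "j < length p" "p ! i \<rightarrow>\<^bsub>G\<^esub> p ! j" for i j
  proof -
    have "p ! j \<rightarrow>\<^bsub>G\<^esub> p ! i"
      using that(3) sym_arcs by (simp add: arcs_ends_symmetric)
    moreover have "i \<noteq> j" using that(3) assms(4) by auto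
    ultimately show ?thesis
      using assms(3)[of i j] assms(3)[of j i] that by linarith
  qed
  ultimately show ?thesis using assms(1) by (auto simp: monophonic_path_def)
qed

section \<open>A monophonic path through an edge and a third vertex\<close>

lemma (in graph) monophonic_path_through_edge:
  assumes conn: "connected G" and tf: "triangle_free G"
    and uv: "u \<rightarrow>\<^bsub>G\<^esub> v" and w: "w \<in> verts G" "w \<noteq> u" "w \<noteq> v"
  shows "\<exists>p. monophonic_path G p \<and> {u, v, w} \<subseteq> set p"
proof -
  define W where "W p \<longleftrightarrow> vwalk p G \<and> hd p = w \<and> last p \<in> {u, v}" for p
  have "strongly_connected G"
    using conn sym_arcs by (rule symmetric_connected_imp_strongly_connected[rotated])
  then have "w \<rightarrow>\<^sup>*\<^bsub>G\<^esub> u"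
    using w uv by (auto simp: strongly_connected_def dest: adj_in_verts)
  then obtain q where "W q"
    unfolding reachable_vwalk_conv W_def by auto
  then obtain p where p: "W p" and min: "\<And>q. W q \<Longrightarrow> length p \<le> length q"
    using ex_has_least_nat[of W _ length] by blast
  have vp: "vwalk p G" and hdp: "hd p = w" and pne: "p \<noteq> []"
    using p by (auto simp: W_def)
  define a where "a = last p"
  \<comment> \<open>The walk may end at \<open>u\<close> or at \<open>v\<close>; from here on
    \<open>a\<close> is the end reached and \<open>b\<close> the other one.\<close>
  obtain b where ab: "{a, b} = {u, v}" "a \<rightarrow>\<^bsub>G\<^esub> b"
  proof (cases "a = u")
    case True
    then show ?thesis using that[of v] uv by simp
  next
    case False
    then have "a = v" using p by (simp add: W_def a_def)
    then show ?thesis using that[of u] arcs_ends_symmetric[OF sym_arcs uv] by auto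
  qed
  have a_nth: "a = p ! i" if "length p = Suc i" for i
    using that pne by (simp add: a_def last_conv_nth)
  have bw: "vwalk [b] G" using ab(2) by (auto simp: vwalk_def dest: adj_in_verts)
  \<comment> \<open>All competitors of \<open>p\<close> below have this shape: a prefix of
    \<open>p\<close> followed by nothing, by \<open>[b]\<close>, or by a suffix of
    \<open>p\<close>.\<close>
  have noshort: "\<not> W (take (Suc i) p @ r)"
    if "Suc i + length r < length p" for i r
    using min[of "take (Suc i) p @ r"] that by auto
  have hdt: "hd (take (Suc i) p @ r) = w" for i r
    using hdp pne by (cases p) auto
  have prefix: "p ! i \<notin> {u, v}" if "Suc i < length p" for i
    using noshort[of i "[]"] hdt[of i "[]"] vwalk_take[OF vp, of "Suc i"] that
    by (auto simp: W_def last_take_Suc)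
  have tob: "\<not> p ! i \<rightarrow>\<^bsub>G\<^esub> b" if "Suc i < length p" for i
  proof
    assume arc: "p ! i \<rightarrow>\<^bsub>G\<^esub> b"
    have "W (take (Suc i) p @ [b])"
      using vwalk_append[OF vwalk_take[OF vp, of "Suc i"] bw] arc that ab hdt[of i "[b]"]
      by (auto simp: W_def last_take_Suc)
    \<comment> \<open>The detour to \<open>b\<close> has \<open>i + 2\<close> vertices, so
      minimality forces \<open>p ! i\<close> to be the last vertex before \<open>a\<close>. Then
      \<open>p ! i\<close>, \<open>a\<close>, \<open>b\<close> form a triangle.\<close>
    then have "length p = Suc (Suc i)"
      using noshort[of i "[b]"] that by force
    then have "p ! i \<rightarrow>\<^bsub>G\<^esub> a" using vwalk_nth_Suc[OF vp that] a_nth by simp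
    moreover have "b \<rightarrow>\<^bsub>G\<^esub> p ! i" using arc sym_arcs by (simp add: arcs_ends_symmetric)
    ultimately show False using ab(2) tf unfolding triangle_free_def by blast
  qed
  have chord: "\<not> p ! i \<rightarrow>\<^bsub>G\<^esub> p ! j" if "Suc i < j" "j < length p" for i j
  proof
    assume "p ! i \<rightarrow>\<^bsub>G\<^esub> p ! j"
    \<comment> \<open>The chord serves as a shortcut, which skips at least one vertex because
      \<open>Suc i < j\<close>.\<close>
    then have "W (take (Suc i) p @ drop j p)"
      using vwalk_append[OF vwalk_take[OF vp, of "Suc i"] vwalk_drop[OF vp, of j]]
        that p hdt[of i "drop j p"]
      by (auto simp: W_def last_take_Suc hd_drop_conv_nth)
    then show False using noshort[of i "drop j p"] that by auto
  qed
  \<comment> \<open>If \<open>j\<close> is not the last position, the arc leaving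
    \<open>p ! j\<close> is a chord from position \<open>i\<close> to \<open>Suc j\<close>.
    Otherwise \<open>p ! i\<close> would be \<open>a\<close>, met too early.\<close>
  have neq: "p ! i \<noteq> p ! j" if "i < j" "j < length p" for i j
  proof
    assume eq: "p ! i = p ! j"
    show False
    proof (cases "Suc j < length p")
      case True
      then show False using chord[of i "Suc j"] vwalk_nth_Suc[OF vp True] eq that by auto
    next
      case False
      then have "p ! j = a" using a_nth[of j] that by simp
      then show False using prefix[of i] eq ab(1) that by auto
    qed
  qed
  have loop: "\<not> x \<rightarrow>\<^bsub>G\<^esub> x" for x using adj_not_same by blast
  have "monophonic_path G (p @ [b])"
  proof (rule monophonic_pathI)
    show "vwalk (p @ [b]) G" using vwalk_append[OF vp bw] ab(2) by (simp add: a_def)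
    show "(p @ [b]) ! i \<noteq> (p @ [b]) ! j" if "i < j" "j < length (p @ [b])" for i j
    proof (cases "j < length p")
      case True
      then show ?thesis using neq that by (simp add: nth_append)
    next
      case False
      then have j: "j = length p" using that by simp
      \<comment> \<open>Vertices before the last lie outside \<open>{u, v}\<close>; the last one is
        \<open>a\<close>, which differs from \<open>b\<close> as there are no loops.\<close>
      have "p ! i \<noteq> b"
      proof (cases "Suc i < length p")
        case True
        then show ?thesis using prefix ab(1) by blast
      next
        case False
        then have "p ! i = a" using a_nth[of i] that j by simp
        then show ?thesis using ab(2) loop by auto
      qed
      then show ?thesis using that j by (simp add: nth_append)
    qed
    show "\<not> (p @ [b]) ! i \<rightarrow>\<^bsub>G\<^esub> (p @ [b]) ! j"
      if "Suc i < j" "j < length (p @ [b])" for i j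
      using that chord[of i j] tob[of i] by (cases "j < length p") (auto simp: nth_append)
    show "\<not> x \<rightarrow>\<^bsub>G\<^esub> x" for x by (rule loop)
  qed
  moreover have "{u, v, w} \<subseteq> set (p @ [b])"
  proof -
    have "a \<in> set p" "w \<in> set p" using pne hdp by (auto simp: a_def)
    then have "{a, b} \<union> {w} \<subseteq> set (p @ [b])" by simp
    then show ?thesis unfolding ab(1) by simp
  qed
  ultimately show ?thesis by blast
qed

section \<open>Comparison of mp-sets with independent sets\<close>

lemma (in graph) mp_set_independent_or_small:
  assumes "connected G" "triangle_free G" "mp_set G M"
  shows "independent_set G M \<or> card M \<le> 2"
proof (cases "independent_set G M")
  case False
  then obtain u v where uv: "u \<in> M" "v \<in> M" "u \<rightarrow>\<^bsub>G\<^esub> v"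
    using assms(3) by (auto simp: independent_set_def mp_set_def)
  then have "u \<noteq> v" using adj_not_same by blast
  have "M \<subseteq> {u, v}"
  proof (rule ccontr)
    assume "\<not> M \<subseteq> {u, v}"
    then obtain w where w: "w \<in> M" "w \<noteq> u" "w \<noteq> v" by auto
    then have "w \<in> verts G" using assms(3) by (auto simp: mp_set_def)
    from monophonic_path_through_edge[OF assms(1,2) uv(3) this w(2,3)]
    show False using assms(3) uv w \<open>u \<noteq> v\<close> unfolding mp_set_def by metis
  qed
  then have "card M \<le> card {u, v}" by (intro card_mono) auto
  then show ?thesis using \<open>u \<noteq> v\<close> by simp
qed simp

lemma (in graph) triangle_free_imp_independent_pair:
  assumes "triangle_free G" "card (verts G) \<ge> 3"
  shows "\<exists>S. independent_set G S \<and> card S = 2"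
proof -
  obtain T where T: "T \<subseteq> verts G" "card T = 3"
    using obtain_subset_with_card_n[OF assms(2)] by metis
  then obtain x y z where xyz: "T = {x, y, z}" "x \<noteq> y" "y \<noteq> z" "x \<noteq> z"
    by (auto simp: card_3_iff)
  obtain s t where st: "s \<in> T" "t \<in> T" "s \<noteq> t" "\<not> s \<rightarrow>\<^bsub>G\<^esub> t"
  proof -
    have "\<not> (x \<rightarrow>\<^bsub>G\<^esub> y \<and> y \<rightarrow>\<^bsub>G\<^esub> z \<and> z \<rightarrow>\<^bsub>G\<^esub> x)"
      using assms(1) unfolding triangle_free_def by blast
    moreover have "x \<in> T" "y \<in> T" "z \<in> T" using xyz(1) by auto
    ultimately show ?thesis using that[of x y] that[of y z] that[of z x] xyz(2-4) by metis
  qed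
  \<comment> \<open>One missing arc suffices: symmetry excludes the reverse arc, and there are no
    loops.\<close>
  then have "independent_set G {s, t}"
    using T(1) sym_arcs adj_not_same by (auto simp: independent_set_def arcs_ends_symmetric)
  then show ?thesis using st(3) by (metis card_2_iff)
qed

lemma independent_set_imp_mp_set:
  assumes short: "\<And>p. monophonic_path G p \<Longrightarrow> vwalk_length p \<le> 3"
    and ind: "independent_set G S"
  shows "mp_set G S"
proof -
  have False
    if S: "x \<in> S" "y \<in> S" "z \<in> S" and ne: "x \<noteq> y" "y \<noteq> z" "x \<noteq> z"
      and p: "monophonic_path G p" and sub: "{x, y, z} \<subseteq> set p" for x y z p
  proof -
    obtain i j k where ijk: "i < length p" "j < length p" "k < length p"
      "p ! i = x" "p ! j = y" "p ! k = z"
      using sub by (auto simp: in_set_conv_nth)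
    have nonconsec: "n \<noteq> Suc m"
      if "m < length p" "n < length p" "p ! m \<in> S" "p ! n \<in> S" for m n
      using that ind p vwalk_nth_Suc[of p G m]
      by (auto simp: independent_set_def monophonic_path_def vpath_def)
    \<comment> \<open>Length counts edges, so there are at most four positions, whereas three
      pairwise distinct and non-consecutive indices need at least five.\<close>
    have "length p \<le> 4" using short[OF p] by simp
    moreover have "i \<noteq> j" "j \<noteq> k" "i \<noteq> k" using ne ijk by auto
    moreover have "j \<noteq> Suc i" "i \<noteq> Suc j" "k \<noteq> Suc j" "j \<noteq> Suc k" "k \<noteq> Suc i" "i \<noteq> Suc k"
      using nonconsec ijk S by blast+
    ultimately show False using ijk(1-3) by linarith
  qed
  then show ?thesis using ind unfolding mp_set_def independent_set_def by blast
qed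

section \<open>Bounds for the two maxima\<close>

lemma (in fin_digraph) card_le_independence_number:
  assumes "independent_set G S"
  shows "card S \<le> independence_number G"
  unfolding independence_number_def
proof (rule Max_ge)
  \<comment> \<open>\<open>Max\<close> bounds its members only on a finite set; finiteness is
    inherited from the power set of the vertices.\<close>
  have "{S. independent_set G S} \<subseteq> Pow (verts G)" by (auto simp: independent_set_def)
  then show "finite (card ` {S. independent_set G S})"
    by (intro finite_imageI) (auto intro: finite_subset)
qed (use assms in auto)

lemma (in fin_digraph) independence_number_le:
  assumes "\<And>S. independent_set G S \<Longrightarrow> card S \<le> k"
  shows "independence_number G \<le> k"
  unfolding independence_number_def
proof (rule Max.boundedI)
  have "{S. independent_set G S} \<subseteq> Pow (verts G)" by (auto simp: independent_set_def)
  then show "finite (card ` {S. independent_set G S})"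
    by (intro finite_imageI) (auto intro: finite_subset)
  have "independent_set G {}" by (simp add: independent_set_def)
  then show "card ` {S. independent_set G S} \<noteq> {}" by blast
qed (use assms in auto)

lemma (in fin_digraph) card_le_mp_number:
  assumes "mp_set G M"
  shows "card M \<le> mp_number G"
  unfolding mp_number_def
proof (rule Max_ge)
  have "{M. mp_set G M} \<subseteq> Pow (verts G)" by (auto simp: mp_set_def)
  then show "finite (card ` {M. mp_set G M})"
    by (intro finite_imageI) (auto intro: finite_subset)
qed (use assms in auto)

lemma (in fin_digraph) mp_number_le:
  assumes "\<And>M. mp_set G M \<Longrightarrow> card M \<le> k"
  shows "mp_number G \<le> k"
  unfolding mp_number_def
proof (rule Max.boundedI)
  have "{M. mp_set G M} \<subseteq> Pow (verts G)" by (auto simp: mp_set_def)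
  then show "finite (card ` {M. mp_set G M})"
    by (intro finite_imageI) (auto intro: finite_subset)
  have "mp_set G {}" by (simp add: mp_set_def)
  then show "card ` {M. mp_set G M} \<noteq> {}" by blast
qed (use assms in auto)

theorem theorem3p2:
  fixes G :: "('a, 'b) pre_digraph"
  assumes "graph G"
    and "connected G"
    and "triangle_free G"
    and "card (verts G) \<ge> 3"
  shows "mp_number G \<le> independence_number G
    \<and> ((\<forall>p. monophonic_path G p \<longrightarrow> vwalk_length p \<le> 3)
        \<longrightarrow> mp_number G = independence_number G)"
proof -
  interpret graph G by (rule assms(1))
  have le: "mp_number G \<le> independence_number G"
  proof (rule mp_number_le)
    fix M assume "mp_set G M"
    then consider "independent_set G M" | "card M \<le> 2"
      using mp_set_independent_or_small assms by blast
    then show "card M \<le> independence_number G"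
    proof cases
      case 1
      then show ?thesis by (rule card_le_independence_number)
    next
      case 2
      \<comment> \<open>An independent pair, which exists among any three vertices, already
        outweighs such an \<open>M\<close>.\<close>
      then show ?thesis
        using triangle_free_imp_independent_pair[OF assms(3,4)] card_le_independence_number
        by (metis le_trans)
    qed
  qed
  moreover have "mp_number G = independence_number G"
    if "\<forall>p. monophonic_path G p \<longrightarrow> vwalk_length p \<le> 3"
  proof (rule antisym[OF le independence_number_le])
    fix S assume "independent_set G S"
    then have "mp_set G S" using independent_set_imp_mp_set that by blast
    then show "card S \<le> mp_number G" by (rule card_le_mp_number)
  qed
  ultimately show ?thesis by blast
qed

end
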